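(* Let $n\ge 4$ and $b\ge 2$, and let $\mathcal{R}[N\cup\{c\}]$ be the principal submatrix of $\mathcal{R}=\mathcal{R}(T_n^{(b)})$ corresponding to the vertex set $N\cup\{c\}$. The eigenvalues of $\mathcal{R}[N\cup\{c\}]$ are $(2n-9)b$ with multiplicity $b-1$, $(n-6)b$ with multiplicity $(n-4)b$, and the remaining two eigenvalues are the roots of the quadratic polynomial $$p(x)=x^2+(n-6)\left[(n-5)(b-1)^2+(n-4)b\right]x+b(n-6)^2\left[(n-4)(n-5)(b-1)^2-(n-3)b^2\right].$$
   Context: Let $n\ge 4$, $b\ge 2$. $I_m$ is the identity matrix of order $m$, $J_{p\times q}$ is the $p\times q$ all-ones matrix, $J_m=J_{m\times m}$, $\mathbf{1}_m$ is the all-ones column vector of length $m$, and $\mathcal{A}_2=\begin{bmatrix}0&1\\1&0\end{bmatrix}$. For a matrix $A$ and index set $S$, $A[S]$ denotes the principal submatrix of $A$ with rows and columns indexed by $S$. Graph and indexing (motivation for the index sets). $T_n$ is the graph on $n$ vertices formed by $n-2$ triangles sharing a common base edge; $T_n^{(b)}$ is obtained from $b$ copies of $T_n$ by identifying one non-base vertex of each copy into a central cut vertex $c$. Its vertices are $1,\dots,b(n-1)+1$ with $c=b(n-1)+1$; in the $k$-th block the vertices $(k-1)(n-1)+i$ with $i=1,2$ are the base vertices and those with $3\le i\le n-1$ are the non-base vertices other than $c$. The set of non-base vertices excluding $c$ is $$N=\{(k-1)(n-1)+i : k=1,\dots,b,\ i=3,4,\dots,n-1\}.$$ The matrix $\mathcal{R}(T_n^{(b)})$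 (for $n\ge 4$) is the symmetric $(b+1)\times(b+1)$ block matrix of order $b(n-1)+1$ (first $b$ block-rows and block-columns of size $n-1$, last one of size $1$) whose first $b$ diagonal blocks are $\mathcal{R}_1$, whose off-diagonal $(i,j)$ blocks with $1\le i\neq j\le b$ are $\mathcal{R}_2$, whose $(i,b+1)$ blocks are $\mathbf{r}_3$ and $(b+1,i)$ blocks are $\mathbf{r}_3^t$ for $1\le i\le b$, and whose $(b+1,b+1)$ block is the scalar $r$, where $$\mathcal{R}_1=\begin{bmatrix}(n-5)(n-2)(b-1)I_2+(n-2)(b-(n-5))\mathcal{A}_2 & -((n-4)b-2)J_{2\times(n-3)}\\ -((n-4)b-2)J_{(n-3)\times 2} & b(n-6)I_{n-3}+(b-(n-5))J_{n-3}\end{bmatrix},$$ $$\mathcal{R}_2=\begin{bmatrix}-(n-5)(n-2)J_2 & 2J_{2\times(n-3)}\\ 2J_{(n-3)\times 2} & -(n-5)J_{n-3}\end{bmatrix},\qquad \mathbf{r}_3=\begin{bmatrix}(n-6)[(n-4)b-(n-3)]\mathbf{1}_2\\ -b(n-6)\mathbf{1}_{n-3}\end{bmatrix},$$ $$r=-(n-5)(n-6)(b-1)^2.$$ Multiplicities of listed values are to be added whenever listed values coincide (i.e. the list describes the roots of the characteristic polynomial); a value listed with multiplicity $0$ is absent from the list. *)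

theory Defs
  imports
    "Jordan_Normal_Form.Char_Poly"
    "Jordan_Normal_Form.DL_Submatrix"
    Complex_Main
begin

definition J_mat :: "nat \<Rightarrow> nat \<Rightarrow> real mat" where
  "J_mat p q = mat p q (\<lambda>_. 1)"

definition ones_vec :: "nat \<Rightarrow> real vec" where
  "ones_vec m = vec m (\<lambda>_. 1)"

definition A2_mat :: "real mat" where
  "A2_mat = mat_of_rows_list 2 [[0, 1], [1, 0]]"

text \<open>Scalars such as \<open>n - 5\<close> can be negative, so they are computed in the reals; the block sizes
  \<open>n - 3\<close> and \<open>n - 1\<close> are natural numbers, without truncation for \<open>n \<ge> 4\<close>.\<close>

definition R1_mat :: "nat \<Rightarrow> nat \<Rightarrow> real mat" where
  "R1_mat n b = four_block_mat
     (((real n - 5) * (real n - 2) * (real b - 1)) \<cdot>\<^sub>m 1\<^sub>m 2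
        + ((real n - 2) * (real b - (real n - 5))) \<cdot>\<^sub>m A2_mat)
     ((- ((real n - 4) * real b - 2)) \<cdot>\<^sub>m J_mat 2 (n - 3))
     ((- ((real n - 4) * real b - 2)) \<cdot>\<^sub>m J_mat (n - 3) 2)
     ((real b * (real n - 6)) \<cdot>\<^sub>m 1\<^sub>m (n - 3)
        + (real b - (real n - 5)) \<cdot>\<^sub>m J_mat (n - 3) (n - 3))"

definition R2_mat :: "nat \<Rightarrow> nat \<Rightarrow> real mat" where
  "R2_mat n b = four_block_mat
     ((- ((real n - 5) * (real n - 2))) \<cdot>\<^sub>m J_mat 2 2)
     (2 \<cdot>\<^sub>m J_mat 2 (n - 3))
     (2 \<cdot>\<^sub>m J_mat (n - 3) 2)
     ((- (real n - 5)) \<cdot>\<^sub>m J_mat (n - 3) (n - 3))"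

definition r3_vec :: "nat \<Rightarrow> nat \<Rightarrow> real vec" where
  "r3_vec n b =
     ((real n - 6) * ((real n - 4) * real b - (real n - 3))) \<cdot>\<^sub>v ones_vec 2
     @\<^sub>v (- (real b * (real n - 6))) \<cdot>\<^sub>v ones_vec (n - 3)"

definition r_scalar :: "nat \<Rightarrow> nat \<Rightarrow> real" where
  "r_scalar n b = - ((real n - 5) * (real n - 6) * (real b - 1)^2)"

text \<open>Matrix indices start at 0: the row index \<open>i < b * (n - 1)\<close> lies in block row \<open>i div (n - 1)\<close>
  at position \<open>i mod (n - 1)\<close>, and the index \<open>b * (n - 1)\<close> is the last block.\<close>

definition R_mat :: "nat \<Rightarrow> nat \<Rightarrow> real mat" where
  "R_mat n b = (let m = n - 1 in
     mat (b * m + 1) (b * m + 1) (\<lambda>(i, j).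
       if i < b * m \<and> j < b * m then
         (if i div m = j div m then R1_mat n b else R2_mat n b) $$ (i mod m, j mod m)
       else if i < b * m then r3_vec n b $ (i mod m)
       else if j < b * m then r3_vec n b $ (j mod m)
       else r_scalar n b))"

text \<open>Vertices are numbered \<open>1, \<dots>, b * (n - 1) + 1\<close>.\<close>

definition cut_vertex :: "nat \<Rightarrow> nat \<Rightarrow> nat" where
  "cut_vertex n b = b * (n - 1) + 1"

definition nonbase_vertices :: "nat \<Rightarrow> nat \<Rightarrow> nat set" where
  "nonbase_vertices n b = {(k - 1) * (n - 1) + i | k i. k \<in> {1..b} \<and> i \<in> {3..n - 1}}"

text \<open>\<open>A[S]\<close> for a set \<open>S\<close> of indices counted from 1; vertex \<open>v\<close> is row and column \<open>v - 1\<close> of \<open>A\<close>.\<close>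

definition principal_submatrix :: "'a mat \<Rightarrow> nat set \<Rightarrow> 'a mat" where
  "principal_submatrix A S = submatrix A {i. Suc i \<in> S} {i. Suc i \<in> S}"

text \<open>The eigenvalues of a real matrix, with algebraic multiplicity, over the complex numbers:
  for an \<open>m \<times> m\<close> matrix this multiset always has \<open>m\<close> elements.\<close>

definition eigenvalue_mset :: "real mat \<Rightarrow> complex multiset" where
  "eigenvalue_mset A = proots (char_poly (map_mat complex_of_real A))"

definition p_poly :: "nat \<Rightarrow> nat \<Rightarrow> real poly" where
  "p_poly n b =
     [: real b * (real n - 6)^2 *
          ((real n - 4) * (real n - 5) * (real b - 1)^2 - (real n - 3) * (real b)^2),
        (real n - 6) * ((real n - 5) * (real b - 1)^2 + (real n - 4) * real b),
        1 :]"

end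

theory Submission
  imports Defs
begin

text \<open>
  Put \<open>q = n - 3\<close>, the number of non-base vertices other than \<open>c\<close> in a block. List these vertices
  block by block and \<open>c\<close> last. Up to the multiple \<open>a = b (n - 6)\<close> of the identity, an entry of the
  principal submatrix then depends only on the cells that contain its row and its column, where the
  cells are the \<open>b\<close> blocks of \<open>q\<close> vertices and \<open>{c}\<close>. With \<open>0\<close>-based indices the cell of \<open>i\<close> is
  \<open>i div q\<close>, also for \<open>c\<close>, whose index \<open>b q\<close> falls into cell \<open>b\<close>
  (\<open>principal_submatrix_entries\<close>).

  A matrix of the form \<open>a I + (B (g i) (g j))\<close> is \<open>a I + U V\<close>, where the columns of \<open>U\<close> are the
  indicators of the cells. The Weinstein--Aronszajn identity replaces \<open>U V\<close> by the smaller product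
  \<open>V U\<close>, that is, by the quotient matrix of the partition; every dimension lost contributes a factor
  \<open>x - a\<close> to the characteristic polynomial (\<open>char_poly_constant_on_cells\<close>).

  This reduction applies twice. The quotient by the cells has order \<open>b + 1\<close>, which gives the
  eigenvalue \<open>a\<close> with multiplicity \<open>(b q + 1) - (b + 1) = (n - 4) b\<close>. As the \<open>b\<close> blocks play equal
  roles, the quotient has the same form again, now with the scalar \<open>d = a + b q = (2 n - 9) b\<close> and the
  two cells "block" and \<open>c\<close>; this gives the eigenvalue \<open>d\<close> with multiplicity \<open>b - 1\<close>. The
  \<open>2 \<times> 2\<close> matrix that remains has the characteristic polynomial \<open>p\<close>. Working with characteristic
  polynomials rather than eigenvectors keeps the multiplicities right when listed values coincide.
\<close>

section \<open>Quotients of matrices that are constant on cells\<close>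

text \<open>The Weinstein--Aronszajn (Sylvester) identity in a form without division: eliminate in the block
  matrix with rows \<open>(x I, U)\<close> and \<open>(V, I)\<close> either the upper right or the lower left block and
  compare determinants. It has to hold over an integral domain, because it is applied to matrices of
  polynomials.\<close>

lemma det_scalar_minus_mult_commute:
  fixes x :: "'a :: idom"
  assumes U: "U \<in> carrier_mat m k" and V: "V \<in> carrier_mat k m"
  shows "x ^ k * det (x \<cdot>\<^sub>m 1\<^sub>m m - U * V) = x ^ m * det (x \<cdot>\<^sub>m 1\<^sub>m k - V * U)"
proof -
  define P where "P = four_block_mat (x \<cdot>\<^sub>m 1\<^sub>m m) U V (1\<^sub>m k)"
  define L1 where "L1 = four_block_mat (1\<^sub>m m) (- U) (0\<^sub>m k m) (1\<^sub>m k)"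
  define L2 where "L2 = four_block_mat (1\<^sub>m m) (0\<^sub>m m k) (- V) (x \<cdot>\<^sub>m 1\<^sub>m k)"
  have carr: "P \<in> carrier_mat (m + k) (m + k)" "L1 \<in> carrier_mat (m + k) (m + k)"
    "L2 \<in> carrier_mat (m + k) (m + k)"
    unfolding P_def L1_def L2_def by auto
  have schur: "x \<cdot>\<^sub>m 1\<^sub>m m - U * V \<in> carrier_mat m m" "x \<cdot>\<^sub>m 1\<^sub>m k - V * U \<in> carrier_mat k k"
    using U V by (simp_all add: minus_carrier_mat)
  have "L1 * P = four_block_mat (x \<cdot>\<^sub>m 1\<^sub>m m - U * V) (0\<^sub>m m k) V (1\<^sub>m k)"
    unfolding L1_def P_def using U V
    by (subst mult_four_block_mat[of _ m m _ k _ k _ _ m _ k]) (auto intro!: cong_four_block_mat)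
  moreover have "det L1 = 1"
    unfolding L1_def using U
    by (subst det_four_block_mat_lower_left_zero[of _ m _ k]) auto
  ultimately have 1: "det P = det (x \<cdot>\<^sub>m 1\<^sub>m m - U * V)"
    using det_mult[OF carr(2,1)] det_four_block_mat_upper_right_zero
      [OF schur(1), of "0\<^sub>m m k" k V "1\<^sub>m k"] U V by simp
  have "L2 * P = four_block_mat (x \<cdot>\<^sub>m 1\<^sub>m m) U (0\<^sub>m k m) (x \<cdot>\<^sub>m 1\<^sub>m k - V * U)"
    unfolding L2_def P_def using U V
    by (subst mult_four_block_mat[of _ m m _ k _ k _ _ m _ k]) (auto intro!: cong_four_block_mat)
  moreover have "det L2 = x ^ k"
    unfolding L2_def using V
    by (subst det_four_block_mat_upper_right_zero[of _ m _ k]) auto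
  ultimately have 2: "x ^ k * det P = x ^ m * det (x \<cdot>\<^sub>m 1\<^sub>m k - V * U)"
    using det_mult[OF carr(3,1)] det_four_block_mat_lower_left_zero
      [OF _ U _ schur(2), of "x \<cdot>\<^sub>m 1\<^sub>m m" "0\<^sub>m k m"] by simp
  show ?thesis using 1 2 by simp
qed

text \<open>The matrix is \<open>a I + U V\<close> with \<open>U\<close> the indicator matrix of the fibres of \<open>g\<close>, and \<open>V U\<close> collects
  the columns of each fibre, whence the factor given by the fibre size. The identity above with
  \<open>x\<close> the polynomial \<open>X - a\<close> compares both characteristic polynomials; \<open>(X - a)\<^sup>k\<close> cancels.\<close>

lemma char_poly_constant_on_cells:
  fixes a :: "'a :: idom" and B :: "nat \<Rightarrow> nat \<Rightarrow> 'a" and g :: "nat \<Rightarrow> nat"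
  assumes g: "\<And>i. i < m \<Longrightarrow> g i < k" and "k \<le> m"
  shows "char_poly (mat m m (\<lambda>(i, j). (if i = j then a else 0) + B (g i) (g j))) =
         [:- a, 1:] ^ (m - k) *
         char_poly (mat k k (\<lambda>(s, t). (if s = t then a else 0)
                                        + B s t * of_nat (card {i. i < m \<and> g i = t})))"
    (is "char_poly ?M = _ * char_poly ?C")
proof -
  define U where "U = mat m k (\<lambda>(i, s). if g i = s then 1 else 0 :: 'a poly)"
  define V where "V = mat k m (\<lambda>(s, j). [:B s (g j):])"
  have UV: "U \<in> carrier_mat m k" "V \<in> carrier_mat k m"
    unfolding U_def V_def by auto
  have "char_poly_matrix ?M = [:- a, 1:] \<cdot>\<^sub>m 1\<^sub>m m - U * V"
  proof (rule eq_matI)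
    fix i j assume "i < dim_row ([:- a, 1:] \<cdot>\<^sub>m 1\<^sub>m m - U * V)"
      "j < dim_col ([:- a, 1:] \<cdot>\<^sub>m 1\<^sub>m m - U * V)"
    then have ij: "i < m" "j < m" using UV by auto
    have "(U * V) $$ (i, j) = (\<Sum>s<k. U $$ (i, s) * V $$ (s, j))"
      using ij UV by (simp add: scalar_prod_def atLeast0LessThan)
    also have "\<dots> = (\<Sum>s<k. (if g i = s then [:B s (g j):] else 0))"
      using ij by (intro sum.cong) (auto simp: U_def V_def)
    also have "\<dots> = [:B (g i) (g j):]"
      using g[OF ij(1)] by simp
    finally show "char_poly_matrix ?M $$ (i, j) = ([:- a, 1:] \<cdot>\<^sub>m 1\<^sub>m m - U * V) $$ (i, j)"
      using ij UV by (simp add: char_poly_matrix_def)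
  qed (use UV in \<open>auto simp: char_poly_matrix_def\<close>)
  moreover have "char_poly_matrix ?C = [:- a, 1:] \<cdot>\<^sub>m 1\<^sub>m k - V * U"
  proof (rule eq_matI)
    fix s t assume "s < dim_row ([:- a, 1:] \<cdot>\<^sub>m 1\<^sub>m k - V * U)"
      "t < dim_col ([:- a, 1:] \<cdot>\<^sub>m 1\<^sub>m k - V * U)"
    then have st: "s < k" "t < k" using UV by auto
    have "(V * U) $$ (s, t) = (\<Sum>i<m. if g i = t then [:B s t:] else 0)"
      using st by (simp add: U_def V_def scalar_prod_def atLeast0LessThan) (auto intro!: sum.cong)
    also have "\<dots> = of_nat (card {i. i < m \<and> g i = t}) * [:B s t:]"
      by (simp add: sum.If_cases Int_def)
    also have "\<dots> = [:B s t * of_nat (card {i. i < m \<and> g i = t}):]"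
      by (simp add: of_nat_poly mult.commute)
    finally show "char_poly_matrix ?C $$ (s, t) = ([:- a, 1:] \<cdot>\<^sub>m 1\<^sub>m k - V * U) $$ (s, t)"
      using st UV by (simp add: char_poly_matrix_def)
  qed (use UV in \<open>auto simp: char_poly_matrix_def\<close>)
  ultimately have "[:- a, 1:] ^ k * char_poly ?M = [:- a, 1:] ^ m * char_poly ?C"
    using det_scalar_minus_mult_commute[OF UV, of "[:- a, 1:]"] by (simp add: char_poly_def)
  also have "\<dots> = [:- a, 1:] ^ k * ([:- a, 1:] ^ (m - k) * char_poly ?C)"
    using \<open>k \<le> m\<close> by (simp add: mult.assoc[symmetric] power_add[symmetric])
  finally show ?thesis by simp
qed

lemma char_poly_2:
  fixes f :: "nat \<times> nat \<Rightarrow> 'a :: comm_ring_1"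
  shows "char_poly (mat 2 2 f) =
    [:f (0, 0) * f (1, 1) - f (0, 1) * f (1, 0), - (f (0, 0) + f (1, 1)), 1:]"
proof -
  have A: "char_poly_matrix (mat 2 2 f) \<in> carrier_mat 2 2" by simp
  show ?thesis
    unfolding char_poly_def laplace_expansion_row[OF A, of 0, simplified]
    by (simp add: numeral_2_eq_2 cofactor_def det_single mat_delete_def char_poly_matrix_def
        algebra_simps)
qed

section \<open>The entries of the principal submatrix\<close>

text \<open>The \<open>i\<close>-th element of a set is the one with exactly \<open>i\<close> elements below it.\<close>

lemma pick_strict_mono_image:
  assumes f: "strict_mono_on {..<m} f" and i: "i < m"
  shows "pick (f ` {..<m}) i = f i"
proof -
  have "{s \<in> f ` {..<m}. s < f i} = f ` {..<i}"
    using f i by (auto simp: strict_mono_on_less intro!: imageI)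
  moreover have "inj_on f {..<i}"
    using strict_mono_on_imp_inj_on[OF f] i by (auto intro: inj_on_subset)
  ultimately have "card {s \<in> f ` {..<m}. s < f i} = i"
    by (simp add: card_image)
  then show ?thesis
    using pick_card_in_set[of "f i" "f ` {..<m}"] i by simp
qed

lemma submatrix_strict_mono_image:
  assumes f: "strict_mono_on {..<m} f" and A: "A \<in> carrier_mat r r"
    and bound: "\<And>i. i < m \<Longrightarrow> f i < r"
  shows "submatrix A (f ` {..<m}) (f ` {..<m}) = mat m m (\<lambda>(i, j). A $$ (f i, f j))"
proof -
  have "{i. i < r \<and> i \<in> f ` {..<m}} = f ` {..<m}" using bound by auto
  then have "card {i. i < r \<and> i \<in> f ` {..<m}} = m"
    using strict_mono_on_imp_inj_on[OF f] by (simp add: card_image)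
  then show ?thesis
    unfolding submatrix_def using A pick_strict_mono_image[OF f] by (auto intro!: eq_matI)
qed

text \<open>The increasing enumeration of the rows belonging to \<open>N\<close> and \<open>c\<close>. A block of \<open>R_mat\<close> has \<open>q + 2\<close>
  rows, of which the first two belong to the base vertices and are skipped.\<close>

definition nonbase_position :: "nat \<Rightarrow> nat \<Rightarrow> nat \<Rightarrow> nat" where
  "nonbase_position q b i =
     (if i < b * q then i div q * (q + 2) + (i mod q + 2) else b * (q + 2))"

lemma strict_mono_nonbase_position:
  assumes "q > 0"
  shows "strict_mono_on {..<b * q + 1} (nonbase_position q b)"
proof (rule strict_mono_onI)
  fix i j assume ij: "i \<in> {..<b * q + 1}" "j \<in> {..<b * q + 1}" "i < j"
  (* i is never the last index, so its position lies inside the block of rows number i div q. *)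
  have i: "nonbase_position q b i < (i div q + 1) * (q + 2)"
    using ij dividend_less_div_times[OF assms, of i] by (simp add: nonbase_position_def)
  show "nonbase_position q b i < nonbase_position q b j"
  proof (cases "i div q < j div q")
    case True
    then have "(i div q + 1) * (q + 2) \<le> (j div q) * (q + 2)"
      by (intro mult_right_mono) auto
    also have "\<dots> \<le> nonbase_position q b j"
    proof (cases "j < b * q")
      case True
      then show ?thesis unfolding nonbase_position_def by (simp only: if_True le_add1)
    next
      case False
      then have "j = b * q" using ij by simp
      then show ?thesis using assms by (simp add: nonbase_position_def)
    qed
    finally show ?thesis using i by simp
  next
    case False
    then have eq: "i div q = j div q" using ij div_le_mono[of i j q] by simp
    then have "i mod q < j mod q"
      using ij(3) by (metis div_mult_mod_eq nat_add_left_cancel_less)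
    moreover have "j < b * q"
    proof (rule ccontr)
      assume "\<not> j < b * q"
      then have "j = b * q" using ij by simp
      then show False using \<open>i mod q < j mod q\<close> by simp
    qed
    ultimately show ?thesis
      using ij(3) by (simp only: nonbase_position_def eq less_trans if_True)
  qed
qed

lemma nonbase_position_image:
  assumes "n \<ge> 4"
  shows "{i. Suc i \<in> nonbase_vertices n b \<union> {cut_vertex n b}} =
         nonbase_position (n - 3) b ` {..<b * (n - 3) + 1}"
proof -
  define q where "q = n - 3"
  have q: "q > 0" "n - 1 = q + 2" "n - Suc 0 = q + 2" using assms by (auto simp: q_def)
  have pos: "nonbase_position q b (k * q + t) = k * (q + 2) + (t + 2)" if "k < b" "t < q" for k t
  proof -
    have "k * q + t < (k + 1) * q" using that by simp
    also have "\<dots> \<le> b * q" using that by (intro mult_right_mono) auto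
    finally show ?thesis using that by (simp add: nonbase_position_def)
  qed
  have "{i. Suc i \<in> nonbase_vertices n b} = nonbase_position q b ` {..<b * q}" (is "?L = ?R")
  proof (intro equalityI subsetI)
    fix v assume "v \<in> ?L"
    then obtain k i where ki: "k \<in> {1..b}" "i \<in> {3..q + 2}" "Suc v = (k - 1) * (q + 2) + i"
      unfolding nonbase_vertices_def q by auto
    then have kt: "k - 1 < b" "i - 3 < q" by auto
    have "v = nonbase_position q b ((k - 1) * q + (i - 3))"
      unfolding pos[OF kt] using ki by auto
    moreover have "(k - 1) * q + (i - 3) < b * q"
    proof -
      have "(k - 1) * q + (i - 3) < (k - 1 + 1) * q" using kt by simp
      also have "\<dots> \<le> b * q" using ki by (intro mult_right_mono) auto
      finally show ?thesis .
    qed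
    ultimately show "v \<in> ?R" by blast
  next
    fix v assume "v \<in> ?R"
    then obtain i where i: "i < b * q" "v = nonbase_position q b i" by auto
    then have "Suc v = ((i div q + 1) - 1) * (q + 2) + (i mod q + 3)"
      by (simp add: nonbase_position_def)
    moreover have "i div q + 1 \<in> {1..b}" "i mod q + 3 \<in> {3..q + 2}"
      using i q by (auto simp: less_mult_imp_div_less Suc_le_eq)
    ultimately show "v \<in> ?L" unfolding nonbase_vertices_def q by blast
  qed
  moreover have "{i. Suc i \<in> {cut_vertex n b}} = {nonbase_position q b (b * q)}"
    by (auto simp: cut_vertex_def nonbase_position_def q)
  ultimately show ?thesis
    unfolding q_def[symmetric] by (auto simp: lessThan_Suc)
qed

text \<open>The scalar \<open>a = b (n - 6)\<close> is split off from every diagonal entry. For the corner this is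
  artificial, hence the correction in the last case; it makes the scalar part a multiple of the whole
  identity matrix.\<close>

definition cell_entry :: "nat \<Rightarrow> nat \<Rightarrow> nat \<Rightarrow> nat \<Rightarrow> real" where
  "cell_entry n b k l =
     (if k < b \<and> l < b then (if k = l then real b else 0) - (real n - 5)
      else if k < b \<or> l < b then - (real b * (real n - 6))
      else r_scalar n b - real b * (real n - 6))"

lemma principal_submatrix_entries:
  assumes "n \<ge> 4"
  shows "principal_submatrix (R_mat n b) (nonbase_vertices n b \<union> {cut_vertex n b}) =
    mat (b * (n - 3) + 1) (b * (n - 3) + 1) (\<lambda>(i, j).
      (if i = j then real b * (real n - 6) else 0)
      + cell_entry n b (i div (n - 3)) (j div (n - 3)))"
proof -
  define q where "q = n - 3"
  have q: "q > 0" "n - 1 = q + 2" "n - Suc 0 = q + 2" using assms by (auto simp: q_def)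
  let ?f = "nonbase_position q b"
  have bound: "?f i < b * (q + 2) + 1" if "i < b * q + 1" for i
    using strict_mono_on_leD[OF strict_mono_nonbase_position[OF q(1), of b], of i "b * q"] that
    by (auto simp: nonbase_position_def)
  have R: "R_mat n b \<in> carrier_mat (b * (q + 2) + 1) (b * (q + 2) + 1)"
    unfolding R_mat_def q Let_def by (rule mat_carrier)
  have pos: "?f i < b * (q + 2)" "?f i div (q + 2) = i div q" "?f i mod (q + 2) = i mod q + 2"
    "i div q < b" if "i < b * q" for i
  proof -
    have mod: "i mod q + 2 < q + 2" using q by simp
    have f: "?f i = i div q * (q + 2) + (i mod q + 2)" using that by (simp add: nonbase_position_def)
    show "?f i div (q + 2) = i div q" "?f i mod (q + 2) = i mod q + 2"
      unfolding f using mod by (simp_all del: add_2_eq_Suc')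
    show "i div q < b" using that by (simp add: less_mult_imp_div_less)
    then show "?f i < b * (q + 2)"
      using strict_mono_onD[OF strict_mono_nonbase_position[OF q(1), of b], of i "b * q"] that
      by (simp add: nonbase_position_def)
  qed
  have last: "?f (b * q) = b * (q + 2)" "b * q div q = b"
    using q by (simp_all add: nonbase_position_def)
  have blocks: "R1_mat n b $$ (s + 2, t + 2) =
        (if s = t then real b * (real n - 6) else 0) + (real b - (real n - 5))"
      "R2_mat n b $$ (s + 2, t + 2) = - (real n - 5)"
      "r3_vec n b $ (s + 2) = - (real b * (real n - 6))" if "s < q" "t < q" for s t
    using that by (auto simp: R1_mat_def R2_mat_def r3_vec_def J_mat_def ones_vec_def A2_mat_def
        mat_of_rows_list_def q_def[symmetric])
  have "R_mat n b $$ (?f i, ?f j) =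
      (if i = j then real b * (real n - 6) else 0) + cell_entry n b (i div q) (j div q)"
    if "i < b * q + 1" "j < b * q + 1" for i j
  proof -
    have entry: "R_mat n b $$ (?f i, ?f j) =
      (if ?f i < b * (q + 2) \<and> ?f j < b * (q + 2) then
         (if ?f i div (q + 2) = ?f j div (q + 2) then R1_mat n b else R2_mat n b)
           $$ (?f i mod (q + 2), ?f j mod (q + 2))
       else if ?f i < b * (q + 2) then r3_vec n b $ (?f i mod (q + 2))
       else if ?f j < b * (q + 2) then r3_vec n b $ (?f j mod (q + 2))
       else r_scalar n b)"
      using bound that by (simp add: R_mat_def Let_def q)
    have mods: "i mod q < q" "j mod q < q" using q by auto
    consider "i < b * q" "j < b * q" | "i < b * q" "j = b * q" | "i = b * q" "j < b * q"
      | "i = b * q" "j = b * q" using \<open>i < b * q + 1\<close> \<open>j < b * q + 1\<close> by linarith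
    then show ?thesis
    proof cases
      case 1
      have "i = j \<longleftrightarrow> i div q = j div q \<and> i mod q = j mod q"
        by (metis div_mult_mod_eq)
      then show ?thesis
        unfolding entry using pos[OF 1(1)] pos[OF 1(2)] blocks[OF mods]
        by (auto simp: cell_entry_def simp del: add_2_eq_Suc')
    next
      case 2
      then show ?thesis
        unfolding entry using pos[OF 2(1)] last blocks[OF mods(1) mods(1)]
        by (auto simp: cell_entry_def simp del: add_2_eq_Suc')
    next
      case 3
      then show ?thesis
        unfolding entry using pos[OF 3(2)] last blocks[OF mods(2) mods(2)]
        by (auto simp: cell_entry_def simp del: add_2_eq_Suc')
    next
      case 4
      then show ?thesis
        unfolding entry using last by (simp add: cell_entry_def)
    qed
  qed
  moreover have "submatrix (R_mat n b) (?f ` {..<b * q + 1}) (?f ` {..<b * q + 1}) =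
      mat (b * q + 1) (b * q + 1) (\<lambda>(i, j). R_mat n b $$ (?f i, ?f j))"
    by (rule submatrix_strict_mono_image[OF strict_mono_nonbase_position[OF q(1)] R bound])
  ultimately show ?thesis
    unfolding principal_submatrix_def nonbase_position_image[OF assms] q_def[symmetric]
    by (simp only:) (rule cong_mat; simp)
qed

section \<open>The characteristic polynomial\<close>

text \<open>The two quotient steps: from order \<open>b q + 1\<close> to order \<open>b + 1\<close>, and from there to order \<open>2\<close>.\<close>

lemma char_poly_principal_submatrix:
  assumes "n \<ge> 4" and "b \<ge> 2"
  shows "char_poly (principal_submatrix (R_mat n b) (nonbase_vertices n b \<union> {cut_vertex n b})) =
    [:- ((real n - 6) * real b), 1:] ^ ((n - 4) * b) *
    [:- ((2 * real n - 9) * real b), 1:] ^ (b - 1) * p_poly n b"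
proof -
  define q where "q = n - 3"
  have q: "q > 0" "real q = real n - 3" using assms by (auto simp: q_def)
  define a where "a = real b * (real n - 6)"
  define d where "d = a + real b * real q"
  (* B s t is the entry of the first quotient between the cell types s and t, after splitting off d:
     type 0 is any of the b blocks and type 1 is the cell of c. The factor q is the number of columns
     in a block. *)
  define B where "B s t = (if s = 0 then (if t = 0 then - (real n - 5) * real q
                                         else - (real b * (real n - 6)))
      else if t = 0 then - (real b * (real n - 6)) * real q
      else r_scalar n b - d)" for s t :: nat
  define h where "h k = (if k < b then 0 else 1 :: nat)" for k
  have fibre: "{i. i < b * q + 1 \<and> i div q = t} = {t * q..<t * q + q}" if "t < b" for t
  proof -
    have le: "t * q + q \<le> b * q" using mult_right_mono[of "t + 1" b q] that by simp
    have iff: "i div q = t \<longleftrightarrow> t * q \<le> i \<and> i < t * q + q" for i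
    proof
      assume "i div q = t"
      then show "t * q \<le> i \<and> i < t * q + q"
        using dividend_less_div_times[OF q(1), of i] by (auto simp: add.commute)
    next
      assume "t * q \<le> i \<and> i < t * q + q"
      then show "i div q = t" by (intro div_nat_eqI) (simp_all add: mult.commute)
    qed
    show ?thesis
    proof (rule Set.set_eqI)
      fix i
      show "i \<in> {i. i < b * q + 1 \<and> i div q = t} \<longleftrightarrow> i \<in> {t * q..<t * q + q}"
        unfolding mem_Collect_eq atLeastLessThan_iff iff using le by linarith
    qed
  qed
  have fibre_last: "{i. i < b * q + 1 \<and> i div q = b} = {b * q}"
    using q by (auto simp: less_Suc_eq less_mult_imp_div_less dest: less_mult_imp_div_less)
  have "char_poly (principal_submatrix (R_mat n b) (nonbase_vertices n b \<union> {cut_vertex n b})) =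
      char_poly (mat (b * q + 1) (b * q + 1) (\<lambda>(i, j). (if i = j then a else 0)
        + cell_entry n b (i div q) (j div q)))"
    unfolding principal_submatrix_entries[OF assms(1)] q_def a_def ..
  also have "\<dots> = [:- a, 1:] ^ (b * q + 1 - (b + 1)) *
      char_poly (mat (b + 1) (b + 1) (\<lambda>(k, l). (if k = l then a else 0)
        + cell_entry n b k l * of_nat (card {i. i < b * q + 1 \<and> i div q = l})))"
  proof (rule char_poly_constant_on_cells)
    show "i div q < b + 1" if "i < b * q + 1" for i
      using that q div_le_mono[of i "b * q" q] by simp
    show "b + 1 \<le> b * q + 1" using q by simp
  qed
  (* In the quotient the extra entries b within a block add up to b * q on the diagonal; moving this
     into the scalar turns a into d and leaves entries that no longer tell the blocks apart. *)
  also have "mat (b + 1) (b + 1) (\<lambda>(k, l). (if k = l then a else 0)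
        + cell_entry n b k l * of_nat (card {i. i < b * q + 1 \<and> i div q = l})) =
      mat (b + 1) (b + 1) (\<lambda>(k, l). (if k = l then d else 0) + B (h k) (h l))"
  proof (rule cong_mat)
    fix k l assume "k < b + 1" "l < b + 1"
    then have kl: "k < b \<or> k = b" "l < b \<or> l = b" by auto
    have card: "card {i. i < b * q + 1 \<and> i div q = l} = (if l < b then q else 1)"
    proof (cases "l < b")
      case True
      show ?thesis unfolding fibre[OF True] using True by simp
    next
      case False
      then have "l = b" using kl(2) by simp
      show ?thesis unfolding \<open>l = b\<close> fibre_last by simp
    qed
    show "(case (k, l) of (k, l) \<Rightarrow> (if k = l then a else 0)
        + cell_entry n b k l * of_nat (card {i. i < b * q + 1 \<and> i div q = l})) =
        (case (k, l) of (k, l) \<Rightarrow> (if k = l then d else 0) + B (h k) (h l))"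
      unfolding prod.case card
      using kl by (auto simp: cell_entry_def B_def h_def d_def a_def algebra_simps)
  qed auto
  also have "char_poly \<dots> = [:- d, 1:] ^ (b + 1 - 2) *
      char_poly (mat 2 2 (\<lambda>(s, t). (if s = t then d else 0)
        + B s t * of_nat (card {k. k < b + 1 \<and> h k = t})))"
    by (rule char_poly_constant_on_cells) (use assms in \<open>auto simp: h_def\<close>)
  also have "char_poly (mat 2 2 (\<lambda>(s, t). (if s = t then d else 0)
        + B s t * of_nat (card {k. k < b + 1 \<and> h k = t}))) = p_poly n b"
  proof -
    have "{k. k < b + 1 \<and> h k = 0} = {..<b}" "{k. k < b + 1 \<and> h k = 1} = {b}"
      by (auto simp: h_def)
    then have c: "card {k. k < b + 1 \<and> h k = 0} = b" "card {k. k < b + 1 \<and> h k = 1} = 1"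
      by simp_all
    show ?thesis
      unfolding char_poly_2 prod.case c
      by (simp add: p_poly_def B_def d_def a_def r_scalar_def q) (simp add: algebra_simps power2_eq_square)
  qed
  also have "a = (real n - 6) * real b" by (simp add: a_def)
  also have "d = (2 * real n - 9) * real b" by (simp add: d_def a_def q algebra_simps)
  also have "b * q + 1 - (b + 1) = (n - 4) * b"
  proof -
    have "n - 4 = q - 1" by (simp add: q_def)
    then show ?thesis by (simp add: algebra_simps)
  qed
  finally show ?thesis by (simp add: mult.assoc)
qed

text \<open>Over the complex numbers the factors of the characteristic polynomial have their roots
  listed separately, and the multisets of roots of nonzero factors add up.\<close>

theorem theorem4p4:
  fixes n b :: nat
  assumes "n \<ge> 4" and "b \<ge> 2"
  shows "eigenvalue_mset
           (principal_submatrix (R_mat n b) (nonbase_vertices n b \<union> {cut_vertex n b})) =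
         replicate_mset (b - 1) (complex_of_real ((2 * real n - 9) * real b)) +
         replicate_mset ((n - 4) * b) (complex_of_real ((real n - 6) * real b)) +
         proots (map_poly complex_of_real (p_poly n b))"
proof -
  let ?M = "principal_submatrix (R_mat n b) (nonbase_vertices n b \<union> {cut_vertex n b})"
  interpret P: map_poly_comm_ring_hom complex_of_real ..
  have M: "?M \<in> carrier_mat (b * (n - 3) + 1) (b * (n - 3) + 1)"
    unfolding principal_submatrix_entries[OF assms(1)] by simp
  have lin: "map_poly complex_of_real [:- x, 1:] = [:- complex_of_real x, 1:]" for x
    by simp
  have p: "map_poly complex_of_real (p_poly n b) \<noteq> 0"
    by (simp add: p_poly_def)
  show ?thesis
    unfolding eigenvalue_mset_def of_real_hom.char_poly_hom[OF M]
      char_poly_principal_submatrix[OF assms] P.hom_mult P.hom_power lin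
    using p by (simp add: proots_mult proots_power add.commute)
qed

end
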